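(* Let $n \in \mathbb{N}$ and $z \in \mathbb{C}$. Define the series $$U_n(z) := \sum_{k \in \mathbb{Z}} \frac{1}{k^n + z^n},$$ under the following domain conditions: if $n$ is odd, then $\Re(z) \in \mathbb{R} \setminus \mathbb{Z}$; if $n$ is even, then $\Re(z) \in \mathbb{R} \setminus \{0\}$. Then $U_n(z)$ admits the finite representation $$U_n(z) = \frac{\pi}{n z^{n-1}} \sum_{k=1}^{n} \frac{a_{k,n} \sin(2\pi z a_{k,n}) + b_{k,n} \sinh(2\pi z b_{k,n})}{\cosh(2\pi z b_{k,n}) - \cos(2\pi z a_{k,n})},$$ where $$a_{k,n} := \cos\left(\frac{(2k-1)\pi}{n}\right), \qquad b_{k,n} := \sin\left(\frac{(2k-1)\pi}{n}\right).$$
   Context: $\mathbb{N}$ denotes the positive integers. The condition for odd $n$ is described as ensuring that the terms $k+z$ avoid poles on the real axis, and the condition for even $n$ as excluding the singularity at $z=0$, where $1/z^n$ diverges.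
   Formalization: It is additionally assumed that k^n + z^n ≠ 0 for every integer k; the stated conditions on Re(z) do not ensure this (n = 3, z = e^{2πi/3}, k = −1), and where it fails both the series and the closed form are undefined. *)

theory Defs
  imports "HOL-Analysis.Analysis"
begin

definition U_term :: "nat \<Rightarrow> complex \<Rightarrow> int \<Rightarrow> complex" where
  "U_term n z k = 1 / (of_int k ^ n + z ^ n)"

definition U_partial :: "nat \<Rightarrow> complex \<Rightarrow> nat \<Rightarrow> complex" where
  "U_partial n z N = (\<Sum>k\<in>{- int N..int N}. U_term n z k)"

text \<open>
  The series over all integers is summed symmetrically. This matters only for \<open>n = 1\<close>, where it
  is not absolutely convergent; for \<open>n \<ge> 2\<close> it agrees with the unconditional sum over the integers.
\<close>

definition U :: "nat \<Rightarrow> complex \<Rightarrow> complex" where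
  "U n z = lim (U_partial n z)"

definition a_coeff :: "nat \<Rightarrow> nat \<Rightarrow> real" where
  "a_coeff k n = cos ((2 * real k - 1) * pi / real n)"

definition b_coeff :: "nat \<Rightarrow> nat \<Rightarrow> real" where
  "b_coeff k n = sin ((2 * real k - 1) * pi / real n)"

end

theory Submission imports Defs
begin

text \<open>
  Let \<open>\<omega>\<close> range over the \<open>n\<close>-th roots of \<open>-1\<close>; their real and imaginary parts are the
  coefficients \<open>a\<close> and \<open>b\<close>. Decomposing \<open>1 / (m ^ n + z ^ n)\<close> into partial fractions with poles
  \<open>\<omega> z\<close> and summing over \<open>m\<close> with Euler's expansion of the cotangent gives
  \<open>\<pi> / (n z ^ (n - 1))\<close> times the sum of \<open>\<omega> cot (\<pi> \<omega> z)\<close>. Euler's expansion is the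
  logarithmic derivative of the reflection formula for the Gamma function. Separating each
  \<open>\<omega> cot (\<pi> \<omega> z)\<close> into its two parts, the part with the factor \<open>\<i>\<close> changes sign
  under \<open>\<omega> \<mapsto> cnj \<omega>\<close> and hence cancels in the sum.
\<close>

section \<open>The cotangent: Euler's expansion and a product-to-sum formula\<close>

lemma Digamma_reflection:
  fixes w :: complex
  assumes w: "w \<notin> \<int>"
  shows "Digamma (1 - w) - Digamma w = of_real pi * cot (of_real pi * w)"
proof -
  have sin_nz: "sin (of_real pi * w) \<noteq> 0"
  proof
    assume "sin (of_real pi * w) = 0"
    then obtain k :: int where "of_real pi * w = of_real (of_int k * pi)"
      by (auto simp: sin_eq_0)
    hence "w = of_int k" by (simp add: field_simps)
    with w show False by simp
  qed
  have w': "1 - w \<notin> \<int>"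
    using w by (metis Ints_1 Ints_diff diff_diff_eq2 add_diff_cancel_left')
  have np: "w \<notin> \<int>\<^sub>\<le>\<^sub>0" "1 - w \<notin> \<int>\<^sub>\<le>\<^sub>0"
    using w w' nonpos_Ints_Int by blast+
  have Gnz: "Gamma w \<noteq> 0" "Gamma (1 - w) \<noteq> 0"
    using np by (simp_all add: Gamma_eq_zero_iff)
  \<comment> \<open>By the reflection formula this and the next function coincide, so uniqueness of
    the derivative equates the two results; the nonzero factor
    \<open>Gamma w * Gamma (1 - w)\<close> then cancels.\<close>
  have "((\<lambda>w. Gamma w * Gamma (1 - w)) has_field_derivative
           Gamma w * Gamma (1 - w) * (Digamma w - Digamma (1 - w))) (at w)"
    using np by (auto intro!: derivative_eq_intros simp: algebra_simps)
  moreover have "((\<lambda>w. of_real pi / sin (of_real pi * w)) has_field_derivative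
           - (of_real pi / sin (of_real pi * w)) * (of_real pi * cot (of_real pi * w))) (at w)"
    using sin_nz by (auto intro!: derivative_eq_intros simp: cot_def field_simps)
  ultimately have "Gamma w * Gamma (1 - w) * (Digamma w - Digamma (1 - w)) =
      - (Gamma w * Gamma (1 - w)) * (of_real pi * cot (of_real pi * w))"
    unfolding Gamma_reflection_complex by (rule DERIV_unique)
  hence "Gamma w * Gamma (1 - w) * (Digamma (1 - w) - Digamma w) =
      Gamma w * Gamma (1 - w) * (of_real pi * cot (of_real pi * w))"
    by (simp add: algebra_simps)
  thus ?thesis
    using Gnz by simp
qed

text \<open>Pairing \<open>-n\<close> with \<open>n + 1\<close> splits the cotangent sum into sums
  over \<open>w + n\<close> and \<open>1 - w + n\<close>, the shape of the \<open>Digamma\<close>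
  limit; only the index \<open>-N\<close> stays unpaired.\<close>

lemma sum_symmetric_int_interval:
  fixes f :: "int \<Rightarrow> 'a :: comm_monoid_add"
  shows "(\<Sum>k\<in>{-int N..int N}. f k) =
    (\<Sum>n<N. f (- int n) + f (int n + 1)) + f (- int N)"
proof (induction N)
  case (Suc N)
  have "{- int (Suc N)..int (Suc N)} =
      insert (int N + 1) (insert (- int (Suc N)) {- int N..int N})"
    by auto
  with Suc show ?case
    by (simp add: ac_simps)
qed simp

text \<open>The partial sum is a difference of the approximants of \<open>Digamma (1 - w)\<close>
  and \<open>Digamma w\<close>, whose logarithms cancel, plus the unpaired term, which tends to
  0.\<close>

lemma cot_symmetric_partial_sums:
  fixes w :: complex
  assumes w: "w \<notin> \<int>"
  shows "(\<lambda>N. \<Sum>k\<in>{-int N..int N}. 1 / (w - of_int k)) \<longlonglongrightarrow>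
    of_real pi * cot (of_real pi * w)"
proof -
  have nz: "w \<noteq> 0" "1 - w \<noteq> 0"
    using w by (auto simp: right_minus_eq)
  let ?A = "\<lambda>v m. of_real (ln (real m)) - (\<Sum>n<m. inverse (v + of_nat n))"
  have eq: "(\<Sum>k\<in>{-int N..int N}. 1 / (w - of_int k)) =
      ?A (1 - w) N - ?A w N + 1 / (w + of_nat N)" for N
  proof -
    have "1 / (w - (of_nat n + 1)) = - inverse (1 - w + of_nat n)" for n
    proof -
      have "w - (of_nat n + 1) = - (1 - w + of_nat n)" by simp
      thus ?thesis by (simp only: inverse_eq_divide minus_divide_right)
    qed
    thus ?thesis
      unfolding sum_symmetric_int_interval
      by (simp add: sum.distrib sum_negf sum_subtractf inverse_eq_divide)
  qed
  have "(\<lambda>N. 1 / (w + of_nat N)) \<longlonglongrightarrow> 0"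
    by (intro tendsto_divide_0[OF tendsto_const] tendsto_add_filterlim_at_infinity[OF tendsto_const]
        tendsto_of_nat)
  hence "(\<lambda>N. ?A (1 - w) N - ?A w N + 1 / (w + of_nat N)) \<longlonglongrightarrow>
      Digamma (1 - w) - Digamma w + 0"
    using nz by (intro tendsto_add tendsto_diff Digamma_LIMSEQ)
  thus ?thesis
    by (simp only: eq Digamma_reflection[OF w] add_0_right)
qed

text \<open>With \<open>p\<close> and \<open>q\<close> as below, the fraction is
  \<open>2 * cos p * sin q\<close> over \<open>2 * sin p * sin q\<close>. If
  \<open>sin p = 0\<close>, both sides are 0 by the convention for division by zero.\<close>

lemma cot_complex_split:
  fixes u v :: complex
  assumes "sin (u - \<i> * v) \<noteq> 0"
  shows "cot (u + \<i> * v) = (sin (2 * u) - \<i> * sinh (2 * v)) / (cosh (2 * v) - cos (2 * u))"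
proof -
  define p q where "p = u + \<i> * v" and "q = u - \<i> * v"
  have uv: "2 * u = p + q" "\<i> * (2 * v) = p - q"
    by (simp_all add: p_def q_def algebra_simps)
  have "sin (2 * u) - \<i> * sinh (2 * v) = 2 * cos p * sin q"
    unfolding sinh_conv_sin uv by (simp add: uv sin_add sin_diff flip: mult.assoc)
  moreover have "cosh (2 * v) - cos (2 * u) = 2 * sin p * sin q"
    unfolding cosh_conv_cos uv by (simp add: cos_add cos_diff)
  moreover have "sin q \<noteq> 0"
    using assms by (simp add: q_def)
  ultimately show ?thesis
    by (simp add: cot_def p_def)
qed

section \<open>Roots of -1 and partial fractions\<close>

definition root_neg_one :: "nat \<Rightarrow> nat \<Rightarrow> complex" where
  "root_neg_one n k = cis ((2 * real k - 1) * pi / real n)"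

lemma root_neg_one_altdef:
  "root_neg_one n k = of_real (a_coeff k n) + \<i> * of_real (b_coeff k n)"
  by (simp add: root_neg_one_def a_coeff_def b_coeff_def complex_eq_iff)

lemma root_neg_one_nonzero [simp]: "root_neg_one n k \<noteq> 0"
  by (simp add: root_neg_one_def)

lemma root_neg_one_power:
  assumes "n \<ge> 1"
  shows "root_neg_one n k ^ n = -1"
proof -
  have "real n * ((2 * real k - 1) * pi / real n) = 2 * real k * pi - pi"
    using assms by (simp add: field_simps)
  hence "root_neg_one n k ^ n = cis (2 * real k * pi - pi)"
    by (simp only: root_neg_one_def Complex.DeMoivre)
  also have "\<dots> = -1"
    by (simp add: complex_eq_iff cos_diff sin_diff)
  finally show ?thesis .
qed

lemma root_neg_one_Suc:
  "root_neg_one n (Suc k) = root_neg_one n k * cis (2 * pi / real n)"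
  by (simp add: root_neg_one_def cis_mult add_divide_distrib algebra_simps diff_divide_distrib)

text \<open>Shifting \<open>k\<close> by one multiplies each summand by \<open>q\<close> and
  permutes the roots cyclically, so the sum is fixed by multiplication by \<open>q\<close>; and
  \<open>q \<noteq> 1\<close> because \<open>n\<close> does not divide \<open>p\<close>.\<close>

lemma sum_root_neg_one_power:
  assumes "0 < p" "p < n"
  shows "(\<Sum>k=1..n. root_neg_one n k ^ p) = 0"
proof -
  define q where "q = cis (2 * pi / real n) ^ p"
  have "q = exp (2 * of_real pi * \<i> * of_nat p / of_nat n)"
    by (simp add: q_def cis_conv_exp mult_ac flip: exp_of_nat_mult)
  hence q: "q \<noteq> 1"
    using complex_root_unity_eq_1[of n p] assms by (auto dest: dvd_imp_le)
  have "root_neg_one n (Suc n) = root_neg_one n 1"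
  proof -
    have "(2 * real (Suc n) - 1) * pi / real n = (2 * real 1 - 1) * pi / real n + 2 * pi"
      using assms by (simp add: field_simps)
    thus ?thesis
      unfolding root_neg_one_def by (simp only: cis_mult[symmetric] cis_2pi mult_1_right)
  qed
  hence "0 = (\<Sum>k=1..n. root_neg_one n (Suc k) ^ p - root_neg_one n k ^ p)"
    using assms by (subst sum_Suc_diff) auto
  also have "\<dots> = (q - 1) * (\<Sum>k=1..n. root_neg_one n k ^ p)"
    unfolding sum_distrib_left
    by (intro sum.cong refl) (simp add: root_neg_one_Suc power_mult_distrib q_def algebra_simps)
  finally show ?thesis
    using q by simp
qed

text \<open>Multiplied by \<open>x ^ n + z ^ n\<close>, each fraction becomes a polynomial in
  \<open>x\<close>, since \<open>x ^ n + z ^ n = x ^ n - (?w k * z) ^ n\<close> is divisible by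
  \<open>x - ?w k * z\<close>. Summing over the roots turns the coefficients into power
  sums.\<close>

lemma partial_fractions_power_plus_power:
  fixes x z :: complex
  assumes n: "n \<ge> 1" and nz: "x ^ n + z ^ n \<noteq> 0" and z: "z \<noteq> 0"
  shows "1 / (x ^ n + z ^ n) = 1 / (of_nat n * z ^ (n - 1)) *
    (\<Sum>k=1..n. root_neg_one n k * (1 / (root_neg_one n k * z - x)))"
proof -
  let ?w = "root_neg_one n"
  have *: "?w k * (1 / (?w k * z - x)) * (x ^ n + z ^ n) =
      - (\<Sum>i<n. x ^ i * z ^ (n - Suc i) * ?w k ^ (n - i))" for k
  proof -
    have pow: "(?w k * z) ^ n = - (z ^ n)"
      using n by (simp add: power_mult_distrib root_neg_one_power)
    hence ne: "?w k * z - x \<noteq> 0"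
      using nz by auto
    have "x ^ n + z ^ n = x ^ n - (?w k * z) ^ n"
      by (simp add: pow)
    also have "\<dots> = (x - ?w k * z) * (\<Sum>i<n. (?w k * z) ^ (n - Suc i) * x ^ i)"
      by (rule power_diff_sumr2)
    also have "\<dots> = - ((?w k * z - x) * (\<Sum>i<n. (?w k * z) ^ (n - Suc i) * x ^ i))"
      by (simp add: algebra_simps)
    finally have "?w k * (1 / (?w k * z - x)) * (x ^ n + z ^ n) =
        - (\<Sum>i<n. ?w k * ((?w k * z) ^ (n - Suc i) * x ^ i))"
      using ne by (simp add: sum_distrib_left)
    also have "(\<Sum>i<n. ?w k * ((?w k * z) ^ (n - Suc i) * x ^ i)) =
        (\<Sum>i<n. x ^ i * z ^ (n - Suc i) * ?w k ^ (n - i))"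
    proof (rule sum.cong[OF refl])
      fix i assume "i \<in> {..<n}"
      hence "n - i = Suc (n - Suc i)" by auto
      thus "?w k * ((?w k * z) ^ (n - Suc i) * x ^ i) = x ^ i * z ^ (n - Suc i) * ?w k ^ (n - i)"
        by (simp add: power_mult_distrib)
    qed
    finally show ?thesis .
  qed
  have "(\<Sum>k=1..n. ?w k * (1 / (?w k * z - x))) * (x ^ n + z ^ n) =
      - (\<Sum>k=1..n. \<Sum>i<n. x ^ i * z ^ (n - Suc i) * ?w k ^ (n - i))"
    unfolding sum_distrib_right * by (simp add: sum_negf)
  also have "(\<Sum>k=1..n. \<Sum>i<n. x ^ i * z ^ (n - Suc i) * ?w k ^ (n - i)) =
      (\<Sum>i<n. x ^ i * z ^ (n - Suc i) * (\<Sum>k=1..n. ?w k ^ (n - i)))"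
    by (subst sum.swap) (simp add: sum_distrib_left)
  \<comment> \<open>For \<open>0 < i < n\<close> the exponent \<open>n - i\<close> lies strictly
    between 0 and \<open>n\<close>, so the power sum vanishes; at \<open>i = 0\<close> it is
    \<open>-n\<close>.\<close>
  also have "\<dots> = (\<Sum>i\<in>{0}. x ^ i * z ^ (n - Suc i) * (\<Sum>k=1..n. ?w k ^ (n - i)))"
    using n by (intro sum.mono_neutral_right) (auto simp: sum_root_neg_one_power[simplified])
  also have "\<dots> = - (of_nat n * z ^ (n - 1))"
    using n by (simp add: root_neg_one_power)
  finally show ?thesis
    using n nz z by (simp add: field_simps)
qed

section \<open>Unconditional summability for exponents at least 2\<close>

lemma summable_norm_inverse_power_plus:
  fixes s c :: complex
  assumes n: "n \<ge> 2" and s: "norm s = 1"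
  shows "summable (\<lambda>m::nat. norm (1 / (s * of_nat m ^ n + c)))"
proof (rule summable_comparison_test_ev)
  \<comment> \<open>From \<open>M\<close> on, \<open>c\<close> takes away at most half of
    \<open>real m ^ n\<close>, which leaves at least \<open>real m ^ 2 / 2\<close>.\<close>
  obtain M :: nat where M: "2 * norm c \<le> real M"
    using real_arch_simple by blast
  show "\<forall>\<^sub>F m in sequentially. norm (norm (1 / (s * of_nat m ^ n + c))) \<le> 2 * inverse (real m ^ 2)"
    using eventually_ge_at_top[of "max 1 M"]
  proof eventually_elim
    case (elim m)
    have m: "real m \<ge> 1" "real m \<ge> 2 * norm c"
      using elim M by auto
    have sq: "real m ^ 2 \<le> real m ^ n"
      using m n by (intro power_increasing) auto
    have "real m \<le> real m ^ 2"
      using m by (simp add: power2_eq_square)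
    hence "2 * norm c \<le> real m ^ n"
      using m sq by linarith
    moreover have "real m ^ n - norm c \<le> norm (s * of_nat m ^ n + c)"
      using norm_diff_ineq[of "s * of_nat m ^ n" c] s by (simp add: norm_mult norm_power)
    ultimately have "real m ^ 2 / 2 \<le> norm (s * of_nat m ^ n + c)"
      using sq by linarith
    hence "inverse (norm (s * of_nat m ^ n + c)) \<le> inverse (real m ^ 2 / 2)"
      using m by (intro le_imp_inverse_le) auto
    thus ?case
      by (simp add: norm_divide field_simps)
  qed
  show "summable (\<lambda>m. 2 * inverse (real m ^ 2))"
    by (intro summable_mult inverse_power_summable) simp
qed

lemma U_term_summable_on:
  assumes n: "n \<ge> 2"
  shows "U_term n z summable_on UNIV"
proof -
  have "(U_term n z \<circ> int) summable_on UNIV"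
    using summable_norm_inverse_power_plus[OF n, of 1 "z ^ n"]
    by (intro norm_summable_imp_summable_on) (simp add: U_term_def o_def)
  hence 1: "U_term n z summable_on range int"
    by (subst summable_on_reindex) auto
  \<comment> \<open>On the negative half-line \<open>(-m) ^ n = (-1) ^ n * m ^ n\<close>, hence the
    unimodular factor \<open>s\<close> in the estimate.\<close>
  have "(U_term n z \<circ> (\<lambda>m. - int m)) summable_on UNIV"
    using summable_norm_inverse_power_plus[OF n, of "(-1) ^ n" "z ^ n"]
    by (intro norm_summable_imp_summable_on)
      (simp add: U_term_def o_def norm_power flip: power_mult_distrib)
  hence 2: "U_term n z summable_on range (\<lambda>m. - int m)"
    by (subst summable_on_reindex) (auto simp: inj_on_def)
  have "UNIV = range int \<union> range (\<lambda>m. - int m)"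
    by (auto intro: int_cases2)
  thus ?thesis
    using summable_on_union[OF 1 2] by simp
qed

text \<open>Lets an unconditional sum over the integers be evaluated along symmetric partial
  sums.\<close>

lemma filterlim_symmetric_int_interval:
  "filterlim (\<lambda>N. {- int N..int N}) (finite_subsets_at_top UNIV) sequentially"
  unfolding filterlim_finite_subsets_at_top
proof (intro allI impI)
  fix X :: "int set" assume X: "finite X \<and> X \<subseteq> UNIV"
  hence "\<forall>\<^sub>F N in sequentially. \<forall>x\<in>X. x \<in> {- int N..int N}"
  proof (intro eventually_ball_finite ballI)
    fix x
    show "\<forall>\<^sub>F N in sequentially. x \<in> {- int N..int N}"
      using eventually_ge_at_top[of "nat \<bar>x\<bar>"] by eventually_elim auto
  qed simp
  thus "\<forall>\<^sub>F N in sequentially. finite {- int N..int N} \<and> X \<subseteq> {- int N..int N} \<and> {- int N..int N} \<subseteq> UNIV"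
    by eventually_elim auto
qed

section \<open>The cotangent sum in closed form and the limit of the series\<close>

lemma sum_root_neg_one_cot:
  fixes z :: complex
  assumes n: "n \<ge> 1" and no_pole: "\<And>k :: int. of_int k ^ n + z ^ n \<noteq> 0"
  shows "(\<Sum>k=1..n. root_neg_one n k * cot (of_real pi * (root_neg_one n k * z))) =
    (\<Sum>k = 1..n.
          (of_real (a_coeff k n) * sin (2 * of_real pi * z * of_real (a_coeff k n))
             + of_real (b_coeff k n) * sinh (2 * of_real pi * z * of_real (b_coeff k n)))
          / (cosh (2 * of_real pi * z * of_real (b_coeff k n))
             - cos (2 * of_real pi * z * of_real (a_coeff k n))))"
    (is "?L = (\<Sum>k=1..n. ?f k)")
proof -
  let ?D = "\<lambda>k. cosh (2 * of_real pi * z * of_real (b_coeff k n))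
             - cos (2 * of_real pi * z * of_real (a_coeff k n))"
  define g where "g k = (of_real (b_coeff k n) * sin (2 * of_real pi * z * of_real (a_coeff k n))
      - of_real (a_coeff k n) * sinh (2 * of_real pi * z * of_real (b_coeff k n))) / ?D k" for k
  have split: "root_neg_one n k * cot (of_real pi * (root_neg_one n k * z)) = ?f k + \<i> * g k" for k
  proof -
    define a b where "a = complex_of_real (a_coeff k n)" and "b = complex_of_real (b_coeff k n)"
    define u v where "u = of_real pi * z * a" and "v = of_real pi * z * b"
    have cnj: "a - \<i> * b = cnj (root_neg_one n k)"
      by (simp add: root_neg_one_altdef a_def b_def)
    \<comment> \<open>A zero would make \<open>z * cnj (root_neg_one n k)\<close> an integer
      \<open>m\<close>; the conjugate is again an \<open>n\<close>-th root of -1, so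
      \<open>m ^ n + z ^ n = 0\<close>.\<close>
    have "sin (u - \<i> * v) \<noteq> 0"
    proof
      assume "sin (u - \<i> * v) = 0"
      then obtain m :: int where "u - \<i> * v = of_real (of_int m * pi)"
        by (auto simp: sin_eq_0)
      moreover have "u - \<i> * v = of_real pi * (z * cnj (root_neg_one n k))"
        unfolding cnj[symmetric] by (simp add: u_def v_def algebra_simps)
      ultimately have "z * cnj (root_neg_one n k) = of_int m"
        by simp
      hence "of_int m ^ n = (z * cnj (root_neg_one n k)) ^ n"
        by simp
      also have "\<dots> = z ^ n * cnj (root_neg_one n k ^ n)"
        by (simp add: power_mult_distrib)
      finally have "of_int m ^ n = z ^ n * cnj (root_neg_one n k ^ n)" .
      with no_pole[of m] show False
        using n by (simp add: root_neg_one_power)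
    qed
    hence "cot (u + \<i> * v) = (sin (2 * u) - \<i> * sinh (2 * v)) / (cosh (2 * v) - cos (2 * u))"
      by (rule cot_complex_split)
    moreover have "u + \<i> * v = of_real pi * (root_neg_one n k * z)"
      by (simp add: root_neg_one_altdef u_def v_def a_def b_def algebra_simps)
    moreover have "(a + \<i> * b) * ((sin (2 * u) - \<i> * sinh (2 * v)) / d) =
        (a * sin (2 * u) + b * sinh (2 * v)) / d + \<i> * ((b * sin (2 * u) - a * sinh (2 * v)) / d)" for d
      by (simp add: algebra_simps add_divide_distrib diff_divide_distrib)
    ultimately show ?thesis
      unfolding g_def by (simp add: root_neg_one_altdef u_def v_def a_def b_def mult.assoc)
  qed
  \<comment> \<open>The index reflection conjugates the root: its angle is subtracted from
    \<open>2 * pi\<close>. Since \<open>g\<close> is odd in \<open>b_coeff\<close>, its sum equals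
    its own negative.\<close>
  have refl_eq: "a_coeff (n + 1 - k) n = a_coeff k n \<and> b_coeff (n + 1 - k) n = - b_coeff k n"
    if "k \<in> {1..n}" for k
  proof -
    have "(2 * real (n + 1 - k) - 1) * pi / real n = 2 * pi - (2 * real k - 1) * pi / real n"
      using that by (simp add: of_nat_diff field_simps)
    thus ?thesis
      unfolding a_coeff_def b_coeff_def by (simp only: cos_diff sin_diff) simp
  qed
  have "(\<Sum>k=1..n. g k) = (\<Sum>k=1..n. g (n + 1 - k))"
    by (rule sum.reindex_bij_witness[of _ "\<lambda>k. n + 1 - k" "\<lambda>k. n + 1 - k"]) auto
  also have "\<dots> = (\<Sum>k=1..n. - g k)"
  proof (rule sum.cong[OF refl])
    fix k assume "k \<in> {1..n}"
    from refl_eq[OF this] show "g (n + 1 - k) = - g k"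
      by (simp add: g_def minus_divide_left)
  qed
  finally have "(\<Sum>k=1..n. g k) = 0"
    by (simp add: sum_negf)
  thus ?thesis
    by (simp only: split sum.distrib flip: sum_distrib_left) simp
qed

text \<open>The sums are exchanged while still finite: each single series of
  \<open>1 / (?w k * z - m)\<close> is not absolutely convergent and is summed
  symmetrically.\<close>

lemma U_partial_tendsto:
  fixes z :: complex
  assumes n: "n \<ge> 1" and no_pole: "\<And>k :: int. of_int k ^ n + z ^ n \<noteq> 0"
  shows "U_partial n z \<longlonglongrightarrow> of_real pi / (of_nat n * z ^ (n - 1)) *
    (\<Sum>k=1..n. root_neg_one n k * cot (of_real pi * (root_neg_one n k * z)))"
proof -
  let ?w = "root_neg_one n"
  have z: "z \<noteq> 0"
    using no_pole[of 0] n by auto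
  have nonint: "?w k * z \<notin> \<int>" for k
  proof
    assume "?w k * z \<in> \<int>"
    then obtain m where "?w k * z = of_int m"
      by (elim Ints_cases)
    hence "of_int m ^ n = ?w k ^ n * z ^ n"
      by (simp flip: power_mult_distrib)
    with no_pole[of m] show False
      using n by (simp add: root_neg_one_power)
  qed
  have eq: "U_partial n z N = 1 / (of_nat n * z ^ (n - 1)) *
      (\<Sum>k=1..n. ?w k * (\<Sum>m\<in>{-int N..int N}. 1 / (?w k * z - of_int m)))" for N
    unfolding U_partial_def U_term_def
    by (simp only: partial_fractions_power_plus_power[OF n no_pole z] sum_distrib_left)
      (rule sum.swap)
  have "U_partial n z \<longlonglongrightarrow> 1 / (of_nat n * z ^ (n - 1)) *
      (\<Sum>k=1..n. ?w k * (of_real pi * cot (of_real pi * (?w k * z))))"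
    unfolding eq[abs_def]
    by (intro tendsto_mult tendsto_const tendsto_sum cot_symmetric_partial_sums nonint)
  thus ?thesis
    by (simp add: sum_distrib_left mult_ac)
qed

text \<open>The conditions on \<open>Re z\<close> leave some zero denominators: for
  \<open>n = 3\<close>, \<open>z = cis (pi / 3)\<close> has real part 1/2, yet
  \<open>1 + z ^ 3 = 0\<close>. The hypothesis \<open>no_pole\<close> excludes them.\<close>

theorem theorem2p1:
  fixes n :: nat and z :: complex
  assumes n_pos: "n \<ge> 1"
    and dom_odd: "odd n \<Longrightarrow> Re z \<notin> \<int>"
    and dom_even: "even n \<Longrightarrow> Re z \<noteq> 0"
    and no_pole: "\<And>k :: int. of_int k ^ n + z ^ n \<noteq> 0"
  shows "U_partial n z \<longlonglongrightarrow> U n z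
    \<and> (n \<ge> 2 \<longrightarrow> (U_term n z has_sum U n z) UNIV)
    \<and> U n z = of_real pi / (of_nat n * z ^ (n - 1)) *
        (\<Sum>k = 1..n.
          (of_real (a_coeff k n) * sin (2 * of_real pi * z * of_real (a_coeff k n))
             + of_real (b_coeff k n) * sinh (2 * of_real pi * z * of_real (b_coeff k n)))
          / (cosh (2 * of_real pi * z * of_real (b_coeff k n))
             - cos (2 * of_real pi * z * of_real (a_coeff k n))))"
proof (intro conjI impI)
  note lim = U_partial_tendsto[OF n_pos no_pole]
  have U: "U n z = of_real pi / (of_nat n * z ^ (n - 1)) *
      (\<Sum>k=1..n. root_neg_one n k * cot (of_real pi * (root_neg_one n k * z)))"
    unfolding U_def by (rule limI[OF lim])
  show partial: "U_partial n z \<longlonglongrightarrow> U n z"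
    unfolding U by (rule lim)
  show "U n z = of_real pi / (of_nat n * z ^ (n - 1)) *
        (\<Sum>k = 1..n.
          (of_real (a_coeff k n) * sin (2 * of_real pi * z * of_real (a_coeff k n))
             + of_real (b_coeff k n) * sinh (2 * of_real pi * z * of_real (b_coeff k n)))
          / (cosh (2 * of_real pi * z * of_real (b_coeff k n))
             - cos (2 * of_real pi * z * of_real (a_coeff k n))))"
    unfolding U sum_root_neg_one_cot[OF n_pos no_pole] ..
  assume "n \<ge> 2"
  hence sum: "(U_term n z has_sum infsum (U_term n z) UNIV) UNIV"
    by (intro has_sum_infsum U_term_summable_on)
  \<comment> \<open>The symmetric sums also converge to the unconditional sum, so uniqueness of
    limits identifies it with \<open>U n z\<close>.\<close>
  hence "U_partial n z \<longlonglongrightarrow> infsum (U_term n z) UNIV"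
    unfolding has_sum_def U_partial_def[abs_def]
    by (rule filterlim_compose[OF _ filterlim_symmetric_int_interval])
  with partial have "U n z = infsum (U_term n z) UNIV"
    by (rule LIMSEQ_unique)
  with sum show "(U_term n z has_sum U n z) UNIV"
    by simp
qed

end
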